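(* Let $k$ and $m$ be integers with $k\geqslant 11$ and $1\leqslant m\leqslant 12$. If $mk=8q$ for some square-free odd positive integer $q$, then the generalized friendship graph $F(k,m)$ is a maximal graph.
   Context: All graphs are finite and simple. The rank of a graph is the rank (over the reals) of its adjacency matrix. A graph is reduced if it has no isolated vertex and no two distinct vertices with the same set of neighbors. A reduced graph $G$ is maximal if it is not a proper induced subgraph of any reduced graph with the same rank as $G$ (equivalently, every reduced graph containing $G$ as a proper induced subgraph has a higher rank). The generalized friendship graph $F(k,m)$ is the graph on $mk+1$ vertices obtained by adding a new vertex to $m$ disjoint copies of the complete graph $K_k$ and joining it to all the vertices of these copies. An integer is square-free if it is not divisible by the square of any integer greater than $1$. *)

theory Defs
  imports
    Jordan_Normal_Form.DL_Rank
    Graph_Theory.Graph_Theory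
    "HOL-Computational_Algebra.Squarefree"
begin

text \<open>
  A finite simple graph is a \<open>pair_graph\<close>: finitely many vertices and an irreflexive,
  symmetric set of pairs of vertices. The vertices are natural numbers. As \<open>\<nat>\<close> is infinite,
  every finite graph that contains a given graph on \<open>\<nat>\<close> as an induced subgraph is isomorphic,
  over that graph, to one on \<open>\<nat>\<close>, so maximality among graphs on \<open>\<nat>\<close> is maximality among all
  finite graphs.
\<close>

type_synonym nat_graph = "nat pair_pre_digraph"

definition neighbors :: "nat_graph \<Rightarrow> nat \<Rightarrow> nat set" where
  "neighbors G v = {w. (v, w) \<in> parcs G}"

text \<open>Rows and columns are indexed by the vertices in increasing order.\<close>

definition adjacency_matrix :: "nat_graph \<Rightarrow> real mat" where
  "adjacency_matrix G =
     (let vs = sorted_list_of_set (pverts G); n = card (pverts G)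
      in mat n n (\<lambda>(i, j). if (vs ! i, vs ! j) \<in> parcs G then 1 else 0))"

definition graph_rank :: "nat_graph \<Rightarrow> nat" where
  "graph_rank G = vec_space.rank (card (pverts G)) (adjacency_matrix G)"

definition reduced_graph :: "nat_graph \<Rightarrow> bool" where
  "reduced_graph G \<longleftrightarrow>
     pair_graph G \<and>
     (\<forall>v\<in>pverts G. neighbors G v \<noteq> {}) \<and>
     (\<forall>u\<in>pverts G. \<forall>v\<in>pverts G. u \<noteq> v \<longrightarrow> neighbors G u \<noteq> neighbors G v)"

definition proper_induced_subgraph :: "nat_graph \<Rightarrow> nat_graph \<Rightarrow> bool" where
  "proper_induced_subgraph G H \<longleftrightarrow>
     induced_subgraph (with_proj G) (with_proj H) \<and> G \<noteq> H"

definition maximal_graph :: "nat_graph \<Rightarrow> bool" where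
  "maximal_graph G \<longleftrightarrow>
     reduced_graph G \<and>
     \<not> (\<exists>H. reduced_graph H \<and> proper_induced_subgraph G H \<and> graph_rank H = graph_rank G)"

text \<open>
  Copy number \<open>c < m\<close> of \<open>K\<^sub>k\<close> has the vertex set \<open>{c * k..<(c + 1) * k}\<close>, that is, the vertices
  \<open>v\<close> with \<open>v div k = c\<close>; the added vertex is \<open>m * k\<close>.
\<close>

definition friendship_graph :: "nat \<Rightarrow> nat \<Rightarrow> nat_graph" where
  "friendship_graph k m =
     \<lparr> pverts = {..m * k},
       parcs = {(u, v). u < m * k \<and> v < m * k \<and> u \<noteq> v \<and> u div k = v div k}
             \<union> {(u, v). u = m * k \<and> v < m * k}
             \<union> {(u, v). u < m * k \<and> v = m * k} \<rparr>"

end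

theory Submission
  imports Defs
begin

text \<open>
  Write \<open>A\<close> for the adjacency matrix of \<open>G = F(k, m)\<close>. It is nonsingular, so the rank of \<open>G\<close> is its
  number of vertices. If a reduced graph of the same rank contains \<open>G\<close> as a proper induced
  subgraph, the column of any additional vertex \<open>v\<close> is a combination, with coefficients \<open>c\<close>, of
  the columns of the vertices of \<open>G\<close>. Let \<open>x\<close> be the 0/1 vector of the neighbours of \<open>v\<close> in \<open>G\<close>.
  Reading off the rows of \<open>G\<close> and the row of \<open>v\<close> gives \<open>A c = x\<close> and \<open>c \<bullet> x = 0\<close>, that is,
  \<open>x\<close> is isotropic for \<open>A\<^sup>-\<^sup>1\<close>. The vector \<open>x = 0\<close> would make \<open>v\<close> isolated, and a column of \<open>A\<close>
  would make \<open>v\<close> a twin of a vertex of \<open>G\<close>. So \<open>G\<close> is maximal as soon as 0 and the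
  columns of \<open>A\<close> are the only isotropic 0/1 vectors (lemma \<open>maximal_graphI\<close>).

  Solving \<open>A c = x\<close> by hand turns isotropy into a Diophantine equation
  (\<open>friendship_graph_isotropic_equation\<close>): if \<open>s\<^sub>j\<close> counts the neighbours of \<open>v\<close> in the \<open>j\<close>-th copy of
  \<open>K\<^sub>k\<close>, \<open>S\<close> is the sum of the \<open>s\<^sub>j\<close>, and \<open>a\<close> is 1 or 0 according to whether \<open>v\<close> is adjacent to the
  hub (the vertex joined to all others), then
  \<open>mk (\<Sum> s\<^sub>j\<^sup>2 - (k - 1) S) = (S - a (k - 1))\<^sup>2\<close>.

  With \<open>mk = 8q\<close> and \<open>q\<close> odd and square-free, \<open>S - a (k - 1) = 4qu\<close> for an integer \<open>u\<close>, and the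
  bounds \<open>0 \<le> S \<le> 8q\<close> leave only \<open>u \<in> {-1, 0, 1, 2}\<close>. The values 0 and 2 produce exactly the zero
  vector and the columns of \<open>A\<close>, and \<open>-1\<close> is impossible by signs. The case \<open>u = 1\<close> is the
  essential one: it says that \<open>\<Sum> s\<^sub>j = 4q + a (k - 1)\<close> and
  \<open>\<Sum> s\<^sub>j (k - s\<^sub>j) = 2q + a (k - 1)\<close>. As \<open>m \<le> 12\<close>, the second sum is less than \<open>4k\<close>. For
  even \<open>m\<close> (lemma \<open>no_solution_even\<close>) this is so small that at most four of the \<open>s\<^sub>j\<close> differ
  from 0 and \<open>k\<close>, because each of these contributes at least \<open>k - 1\<close>; in the few configurations
  left, the first sum does not have the right residue modulo \<open>k\<close> or \<open>q\<close> is not odd or has the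
  wrong size. For odd \<open>m\<close> (lemma \<open>no_solution_odd\<close>) the first sum is near \<open>k / 2\<close>
  modulo \<open>k\<close>, which forces the second to be of the order of \<open>k\<^sup>2 / 4\<close>.
\<close>

section \<open>Maximality of nonsingular graphs\<close>

text \<open>
  More columns than the rank are linearly dependent. The dependency is written in graph terms: for
  a function \<open>c\<close> supported on \<open>W\<close>, the entry of \<open>A c\<close> at \<open>i\<close> is the sum of \<open>c\<close> over the
  neighbours of \<open>i\<close> in \<open>W\<close>.
\<close>
lemma kernel_vector_of_rank_less:
  assumes H: "finite (pverts H)" and W: "W \<subseteq> pverts H"
    and rank: "graph_rank H < card W"
  obtains c :: "nat \<Rightarrow> real"
  where "\<exists>j\<in>W. c j \<noteq> 0" and "\<And>i. i \<in> pverts H \<Longrightarrow> sum c (neighbors H i \<inter> W) = 0"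
proof -
  define vs where "vs = sorted_list_of_set (pverts H)"
  define N where "N = card (pverts H)"
  define col_of where "col_of j = vec N (\<lambda>i. of_bool ((vs ! i, j) \<in> parcs H) :: real)" for j
  have set_vs: "set vs = pverts H" and len: "length vs = N"
    using H by (simp_all add: vs_def N_def)
  have finW: "finite W" using H W finite_subset by blast
  have M: "adjacency_matrix H \<in> carrier_mat N N"
    by (simp add: adjacency_matrix_def Let_def N_def)
  interpret vec_space "TYPE(real)" N .
  have cols: "col_of ` W \<subseteq> set (cols (adjacency_matrix H))"
  proof
    fix y assume "y \<in> col_of ` W"
    then obtain j where j: "j \<in> W" "y = col_of j" by auto
    then obtain l where l: "l < N" "vs ! l = j"
      using W set_vs len by (metis in_set_conv_nth subsetD)
    have "col (adjacency_matrix H) l = col_of j"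
      using l M by (intro eq_vecI)
        (auto simp: adjacency_matrix_def Let_def N_def vs_def col_of_def)
    moreover have "col (adjacency_matrix H) l \<in> set (cols (adjacency_matrix H))"
      using l M by (auto simp: cols_def)
    ultimately show "y \<in> set (cols (adjacency_matrix H))" using j by simp
  qed
  show thesis
  \<comment> \<open>Linear dependency is a notion for sets of vectors, so that two equal columns have to be
    treated apart.\<close>
  proof (cases "inj_on col_of W")
    case False
    then obtain x y where xy: "x \<in> W" "y \<in> W" "x \<noteq> y" "col_of x = col_of y"
      by (auto simp: inj_on_def)
    define c :: "nat \<Rightarrow> real" where "c j = of_bool (j = x) - of_bool (j = y)" for j
    have "sum c (neighbors H i \<inter> W) = 0" if i: "i \<in> pverts H" for i
    proof -
      obtain l where l: "l < N" "vs ! l = i"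
        using i set_vs len by (metis in_set_conv_nth)
      have "col_of x $ l = col_of y $ l" using xy by simp
      then have "(i, x) \<in> parcs H \<longleftrightarrow> (i, y) \<in> parcs H"
        using l by (auto simp: col_of_def split: if_splits)
      then show ?thesis
        using xy finW by (simp add: c_def sum_subtractf neighbors_def of_bool_def sum.delta)
    qed
    moreover have "c x \<noteq> 0" using xy by (simp add: c_def)
    ultimately show thesis using that xy by blast
  next
    case True
    have dim: "col_of ` W \<subseteq> carrier_vec N" by (auto simp: col_of_def)
    have "lin_dep (col_of ` W)"
      using rank_ge_card_indpt[OF M cols] rank card_image[OF True]
      by (auto simp: graph_rank_def N_def)
    then obtain a where a: "lincomb a (col_of ` W) = 0\<^sub>v N" "\<exists>v\<in>col_of ` W. a v \<noteq> 0"
      using finite_lin_indpt2[of "col_of ` W"] finW dim by auto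
    define c where "c j = a (col_of j)" for j
    have "sum c (neighbors H i \<inter> W) = 0" if i: "i \<in> pverts H" for i
    proof -
      obtain l where l: "l < N" "vs ! l = i"
        using i set_vs len by (metis in_set_conv_nth)
      have entry: "col_of j $ l = of_bool ((i, j) \<in> parcs H)" for j
        using l by (simp add: col_of_def)
      have "0 = lincomb a (col_of ` W) $ l" using a l by simp
      also have "\<dots> = (\<Sum>j\<in>W. c j * of_bool ((i, j) \<in> parcs H))"
        using l entry by (simp add: lincomb_index[OF _ dim] sum.reindex[OF True] c_def)
      also have "\<dots> = sum c (neighbors H i \<inter> W)"
        using finW by (auto simp: neighbors_def intro!: sum.mono_neutral_cong_right)
      finally show ?thesis by simp
    qed
    then show thesis using that a by (auto simp: c_def)
  qed
qed

text \<open>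
  One condition in place of the hierarchy of locales that \<open>pair_graph\<close> is built from.
\<close>
lemma pair_graph_iff:
  "pair_graph G \<longleftrightarrow> finite (pverts G) \<and>
    (\<forall>u v. (u, v) \<in> parcs G \<longrightarrow> u \<in> pverts G \<and> v \<in> pverts G \<and> u \<noteq> v \<and> (v, u) \<in> parcs G)"
  (is "?L \<longleftrightarrow> ?R")
proof
  assume ?L
  then show ?R
    unfolding pair_graph_def pair_digraph_def pair_pseudo_graph_def pair_fin_digraph_def
      pair_fin_digraph_axioms_def pair_sym_digraph_def pair_sym_digraph_axioms_def
      pair_loopfree_digraph_def pair_loopfree_digraph_axioms_def pair_wf_digraph_def
      symmetric_def sym_def with_proj_simps
    by fastforce
next
  assume R: ?R
  have "parcs G \<subseteq> pverts G \<times> pverts G"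
    using R by auto
  moreover have "finite (pverts G \<times> pverts G)"
    using R by simp
  ultimately have "finite (parcs G)"
    by (rule finite_subset)
  then show ?L
    using R
    unfolding pair_graph_def pair_digraph_def pair_pseudo_graph_def pair_fin_digraph_def
      pair_fin_digraph_axioms_def pair_sym_digraph_def pair_sym_digraph_axioms_def
      pair_loopfree_digraph_def pair_loopfree_digraph_axioms_def pair_wf_digraph_def
      symmetric_def sym_def with_proj_simps
    by fastforce
qed

text \<open>
  A criterion for maximality of a graph with nonsingular adjacency matrix \<open>A\<close>. The neighbourhood
  \<open>X\<close> in \<open>G\<close> of a new vertex of an extension of the same rank satisfies \<open>A c = 1\<^sub>X\<close> and
  \<open>c \<bullet> 1\<^sub>X = 0\<close> for some \<open>c\<close>. Since the row of the new vertex in the larger graph is then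
  determined by \<open>c\<close>, hence by \<open>X\<close>, the vertex is isolated for \<open>X = {}\<close> and a twin of \<open>w\<close> if \<open>X\<close> is
  the neighbourhood of \<open>w\<close>.
\<close>
lemma maximal_graphI:
  assumes G: "reduced_graph G"
    and nonsingular: "\<And>c :: nat \<Rightarrow> real. \<forall>i\<in>pverts G. sum c (neighbors G i) = 0 \<Longrightarrow> \<forall>i\<in>pverts G. c i = 0"
    and isotropic: "\<And>X (c :: nat \<Rightarrow> real). \<lbrakk>X \<subseteq> pverts G; \<forall>i\<in>pverts G. sum c (neighbors G i) = of_bool (i \<in> X);
        sum c X = 0\<rbrakk> \<Longrightarrow> X = {} \<or> (\<exists>w\<in>pverts G. X = neighbors G w)"
  shows "maximal_graph G"
  unfolding maximal_graph_def
proof (intro conjI notI)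
  assume "\<exists>H. reduced_graph H \<and> proper_induced_subgraph G H \<and> graph_rank H = graph_rank G"
  then obtain H where H: "reduced_graph H" and sub: "proper_induced_subgraph G H"
    and rank: "graph_rank H = graph_rank G" by blast
  have G_wf: "finite (pverts G)" "\<And>u v. (u, v) \<in> parcs G \<Longrightarrow> v \<in> pverts G \<and> (v, u) \<in> parcs G"
    using G by (auto simp: reduced_graph_def pair_graph_iff)
  have H_wf: "finite (pverts H)" "\<And>u v. (u, v) \<in> parcs H \<Longrightarrow> u \<in> pverts H \<and> v \<in> pverts H \<and> u \<noteq> v"
    and symH: "\<And>u v. (u, v) \<in> parcs H \<Longrightarrow> (v, u) \<in> parcs H"
    using H by (auto simp: reduced_graph_def pair_graph_iff)
  have VG: "pverts G \<subseteq> pverts H"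
    and arcs: "parcs G = {e \<in> parcs H. fst e \<in> pverts G \<and> snd e \<in> pverts G}"
    using sub by (auto simp: proper_induced_subgraph_def induced_subgraph_def subgraph_def)
  have nbG: "neighbors G i = neighbors H i \<inter> pverts G" if "i \<in> pverts G" for i
    using that arcs by (auto simp: neighbors_def)
  have finN: "finite (neighbors G i)" for i
    by (rule finite_subset[OF _ G_wf(1)]) (auto simp: neighbors_def dest: G_wf(2))
  obtain v where v: "v \<in> pverts H" "v \<notin> pverts G"
  proof -
    have "pverts G \<noteq> pverts H"
    proof
      assume eq: "pverts G = pverts H"
      then have "parcs G = parcs H"
        using arcs H_wf(2) by auto
      then show False using eq sub by (simp add: proper_induced_subgraph_def)
    qed
    then show thesis using VG that by auto
  qed
  have "graph_rank G \<le> card (pverts G)"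
    unfolding graph_rank_def
    by (rule vec_space.rank_le_nc) (simp add: adjacency_matrix_def Let_def)
  then have "graph_rank H < card (insert v (pverts G))"
    using rank v G_wf(1) by simp
  then obtain c0 :: "nat \<Rightarrow> real" where c0: "\<exists>j\<in>insert v (pverts G). c0 j \<noteq> 0"
    and ker0: "\<And>i. i \<in> pverts H \<Longrightarrow> sum c0 (neighbors H i \<inter> insert v (pverts G)) = 0"
    using kernel_vector_of_rank_less[of H "insert v (pverts G)"] VG v H_wf(1) by blast
  have ker: "sum c0 (neighbors H i \<inter> pverts G) + of_bool (v \<in> neighbors H i) * c0 v = 0"
    if "i \<in> pverts H" for i
    using ker0[OF that] v G_wf(1) by (auto simp: Int_insert_right)
  \<comment> \<open>A dependency that avoids the new vertex would contradict the nonsingularity of \<open>G\<close>.\<close>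
  have c0v: "c0 v \<noteq> 0"
  proof
    assume "c0 v = 0"
    then have "\<forall>i\<in>pverts G. sum c0 (neighbors G i) = 0"
      using ker VG nbG by auto
    then show False using nonsingular c0 \<open>c0 v = 0\<close> by auto
  qed
  \<comment> \<open>Normalised so that column \<open>v\<close> is the combination of the columns of \<open>G\<close> with coefficients \<open>c\<close>.\<close>
  define c where "c j = - c0 j / c0 v" for j
  have c: "sum c (neighbors H i \<inter> pverts G) = of_bool (v \<in> neighbors H i)" if "i \<in> pverts H" for i
  proof -
    have "sum c (neighbors H i \<inter> pverts G) = - sum c0 (neighbors H i \<inter> pverts G) / c0 v"
      by (simp add: c_def sum_divide_distrib[symmetric] sum_negf)
    moreover have "sum c0 (neighbors H i \<inter> pverts G) = - (of_bool (v \<in> neighbors H i) * c0 v)"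
      using ker[OF that] by linarith
    ultimately show ?thesis using c0v by simp
  qed
  define X where "X = neighbors H v \<inter> pverts G"
  have Ac: "\<forall>i\<in>pverts G. sum c (neighbors G i) = of_bool (i \<in> X)"
  proof
    fix i assume i: "i \<in> pverts G"
    then have "v \<in> neighbors H i \<longleftrightarrow> i \<in> X"
      using symH by (auto simp: X_def neighbors_def)
    then show "sum c (neighbors G i) = of_bool (i \<in> X)"
      using c[of i] i VG nbG by auto
  qed
  \<comment> \<open>This is row \<open>v\<close>, whose entry at \<open>v\<close> is 0 for want of loops.\<close>
  have "sum c X = 0"
    using c[OF v(1)] H_wf(2)[of v v] by (auto simp: X_def neighbors_def)
  with isotropic[of X c] Ac have "X = {} \<or> (\<exists>w\<in>pverts G. X = neighbors G w)"
    by (auto simp: X_def)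
  then show False
  proof (elim disjE bexE)
    assume "X = {}"
    then have "c j = 0" if "j \<in> pverts G" for j
      using nonsingular[of c] Ac that by auto
    then have "v \<notin> neighbors H i" if "i \<in> pverts H" for i
      using c[OF that] by auto
    then have "(i, v) \<notin> parcs H" for i
      using H_wf(2) by (auto simp: neighbors_def)
    then have "neighbors H v = {}"
      using symH by (auto simp: neighbors_def)
    then show False using H v by (auto simp: reduced_graph_def)
  next
    fix w assume w: "w \<in> pverts G" and X: "X = neighbors G w"
    \<comment> \<open>\<open>c\<close> and the unit vector at \<open>w\<close> solve the same nonsingular system, so they agree.\<close>
    have "\<forall>i\<in>pverts G. sum (\<lambda>j. c j - of_bool (j = w)) (neighbors G i) = 0"
    proof
      fix i assume i: "i \<in> pverts G"
      have "w \<in> neighbors G i \<longleftrightarrow> i \<in> X"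
        using X G_wf(2) by (auto simp: neighbors_def)
      then show "sum (\<lambda>j. c j - of_bool (j = w)) (neighbors G i) = 0"
        using Ac i finN by (simp add: sum_subtractf of_bool_def)
    qed
    then have cw: "c j = of_bool (j = w)" if "j \<in> pverts G" for j
      using nonsingular that by fastforce
    have "v \<in> neighbors H i \<longleftrightarrow> w \<in> neighbors H i" if "i \<in> pverts H" for i
    proof -
      have "sum c (neighbors H i \<inter> pverts G) = sum (\<lambda>j. of_bool (j = w)) (neighbors H i \<inter> pverts G)"
        using cw by (intro sum.cong) auto
      also have "\<dots> = of_bool (w \<in> neighbors H i)"
        using w G_wf(1) by (simp add: of_bool_def)
      finally show ?thesis using c[OF that] by (metis of_bool_eq_iff)
    qed
    then have "(i, v) \<in> parcs H \<longleftrightarrow> (i, w) \<in> parcs H" for i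
      using H_wf(2) by (auto simp: neighbors_def)
    then have "(v, i) \<in> parcs H \<longleftrightarrow> (w, i) \<in> parcs H" for i
      using symH by metis
    then have "neighbors H v = neighbors H w"
      by (simp add: neighbors_def)
    moreover have "w \<in> pverts H" "v \<noteq> w" using v w VG by auto
    ultimately show False using H v(1) unfolding reduced_graph_def by blast
  qed
qed (fact G)

section \<open>Linear algebra of the friendship graph\<close>

lemma in_block_iff:
  fixes k :: nat
  assumes "k > 0"
  shows "v \<in> {j * k..<j * k + k} \<longleftrightarrow> v div k = j"
proof
  assume "v \<in> {j * k..<j * k + k}"
  then show "v div k = j" by (intro div_nat_eqI) (auto simp: mult.commute)
next
  assume "v div k = j"
  then have "v = j * k + v mod k" by (metis div_mult_mod_eq)
  then have "j * k \<le> v \<and> v < j * k + k" using mod_less_divisor[OF assms, of v] by linarith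
  then show "v \<in> {j * k..<j * k + k}" by simp
qed

lemma div_less_copies_iff:
  fixes k :: nat
  assumes "k > 0"
  shows "v div k < m \<longleftrightarrow> v < m * k"
  using assms by (simp add: div_less_iff_less_mult)

lemma neighbors_friendship_graph:
  assumes "k > 0"
  shows "neighbors (friendship_graph k m) i =
    (if i < m * k then insert (m * k) ({i div k * k..<i div k * k + k} - {i})
     else if i = m * k then {..<m * k} else {})"
proof -
  have "v < m * k" if "i < m * k" "v div k = i div k" for v
    using that div_less_copies_iff[OF assms] by metis
  then have "{v. v < m * k \<and> i \<noteq> v \<and> i div k = v div k} = {i div k * k..<i div k * k + k} - {i}"
    if "i < m * k"
    using that in_block_iff[OF assms] by (auto simp del: atLeastLessThan_iff)
  then show ?thesis
    by (auto simp: neighbors_def friendship_graph_def simp del: atLeastLessThan_iff)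
qed

lemma pverts_friendship_graph: "pverts (friendship_graph k m) = {..m * k}"
  by (simp add: friendship_graph_def)

lemma reduced_friendship_graph:
  assumes "k \<ge> 2" and "m \<ge> 1"
  shows "reduced_graph (friendship_graph k m)"
  unfolding reduced_graph_def
proof (intro conjI ballI impI)
  let ?G = "friendship_graph k m"
  show "pair_graph ?G"
    by (auto simp: pair_graph_iff friendship_graph_def)
  have k0: "k > 0" using assms by simp
  note nb = neighbors_friendship_graph[OF k0]
  show "neighbors ?G v \<noteq> {}" if "v \<in> pverts ?G" for v
    using that assms by (auto simp: nb pverts_friendship_graph lessThan_empty_iff)
  fix u v assume uv: "u \<in> pverts ?G" "v \<in> pverts ?G" "u \<noteq> v"
  show "neighbors ?G u \<noteq> neighbors ?G v"
  proof (cases "v \<in> neighbors ?G u")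
    case True
    moreover have "v \<notin> neighbors ?G v" by (simp add: nb)
    ultimately show ?thesis by blast
  next
    case False
    then have uv': "u < m * k" "v < m * k" "v div k \<noteq> u div k"
      using uv in_block_iff[OF k0, of v "u div k"]
      by (auto simp: nb pverts_friendship_graph split: if_splits)
    have "{u div k * k..<u div k * k + k} - {u} \<noteq> {}"
    proof
      assume "{u div k * k..<u div k * k + k} - {u} = {}"
      then have "card {u div k * k..<u div k * k + k} \<le> card {u}"
        by (intro card_mono) auto
      then show False using assms by simp
    qed
    then obtain w where w: "w \<in> {u div k * k..<u div k * k + k}" "w \<noteq> u" by blast
    then have "w div k = u div k" using in_block_iff[OF k0] by blast
    then have "w < m * k" using uv' div_less_copies_iff[OF k0] by metis
    then have "w \<notin> neighbors ?G v"
      using uv' \<open>w div k = u div k\<close> in_block_iff[OF k0, of w "v div k"] by (auto simp: nb)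
    moreover have "w \<in> neighbors ?G u" using w uv' by (simp add: nb)
    ultimately show ?thesis by blast
  qed
qed

text \<open>
  Elimination in the system \<open>A c = x\<close>. At a vertex \<open>i\<close> of copy \<open>j\<close> the equation says that
  the total \<open>C j\<close> of \<open>c\<close> over the copy, minus \<open>c i\<close>, plus the value of \<open>c\<close> at the hub, is \<open>x i\<close>;
  summation over the copy, and then over all copies, gives the other two equations.
\<close>
lemma friendship_graph_linear_system:
  fixes c x :: "nat \<Rightarrow> real"
  assumes k: "k > 0"
    and sol: "\<forall>i\<in>pverts (friendship_graph k m). sum c (neighbors (friendship_graph k m) i) = x i"
  defines "C \<equiv> \<lambda>j. sum c {j * k..<j * k + k}"
    and "s \<equiv> \<lambda>j. sum x {j * k..<j * k + k}"
  shows "\<And>i. i < m * k \<Longrightarrow> c i = C (i div k) + c (m * k) - x i"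
    and "\<And>j. j < m \<Longrightarrow> (real k - 1) * C j = s j - real k * c (m * k)"
    and "real (m * k) * c (m * k) = (\<Sum>j<m. s j) - (real k - 1) * x (m * k)"
proof -
  note nb = neighbors_friendship_graph[OF k]
  show *: "c i = C (i div k) + c (m * k) - x i" if i: "i < m * k" for i
  proof -
    let ?B = "{i div k * k..<i div k * k + k}"
    have "i \<in> ?B" using in_block_iff[OF k] by blast
    have "m * k \<notin> ?B" using in_block_iff[OF k, of "m * k" "i div k"] div_less_copies_iff[OF k, of i m] i k by auto
    have "x i = sum c (insert (m * k) (?B - {i}))"
      using sol[rule_format, of i] i by (simp add: pverts_friendship_graph nb)
    also have "\<dots> = c (m * k) + sum c (?B - {i})"
      using \<open>m * k \<notin> ?B\<close> by (subst sum.insert) blast+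
    also have "sum c (?B - {i}) = C (i div k) - c i"
      unfolding C_def using \<open>i \<in> ?B\<close> by (simp only: sum_diff1 finite_atLeastLessThan if_True)
    finally show ?thesis by simp
  qed
  show **: "(real k - 1) * C j = s j - real k * c (m * k)" if j: "j < m" for j
  proof -
    have "C j = (\<Sum>i\<in>{j * k..<j * k + k}. C j + c (m * k) - x i)"
      unfolding C_def
    proof (rule sum.cong[OF refl])
      fix i assume "i \<in> {j * k..<j * k + k}"
      then have "i div k = j" using in_block_iff[OF k] by blast
      moreover from this have "i < m * k" using j div_less_copies_iff[OF k] by blast
      ultimately show "c i = sum c {j * k..<j * k + k} + c (m * k) - x i" using *[of i] by (simp add: C_def)
    qed
    also have "\<dots> = real k * (C j + c (m * k)) - s j"
      by (simp add: sum_subtractf s_def)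
    finally show ?thesis by (simp add: algebra_simps)
  qed
  have "x (m * k) = sum c {..<m * k}"
    using sol[rule_format, of "m * k"] by (simp add: pverts_friendship_graph nb)
  also have "\<dots> = (\<Sum>j<m. C j)"
    unfolding C_def by (rule sum.nat_group[symmetric])
  finally have "(real k - 1) * x (m * k) = (\<Sum>j<m. s j - real k * c (m * k))"
    using ** by (simp add: sum_distrib_left)
  then show "real (m * k) * c (m * k) = (\<Sum>j<m. s j) - (real k - 1) * x (m * k)"
    by (simp add: sum_subtractf)
qed

lemma friendship_graph_nonsingular:
  fixes c :: "nat \<Rightarrow> real"
  assumes k: "k \<ge> 2" and m: "m \<ge> 1"
    and ker: "\<forall>i\<in>pverts (friendship_graph k m). sum c (neighbors (friendship_graph k m) i) = 0"
  shows "\<forall>i\<in>pverts (friendship_graph k m). c i = 0"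
proof
  have k0: "k > 0" using k by simp
  note sys = friendship_graph_linear_system[OF k0, of m c "\<lambda>_. 0", OF ker]
  have hub: "c (m * k) = 0" using sys(3) k m by simp
  have "sum c {j * k..<j * k + k} = 0" if "j < m" for j
    using sys(2)[OF that] hub k by simp
  moreover fix i assume "i \<in> pverts (friendship_graph k m)"
  ultimately show "c i = 0"
    using sys(1)[of i] hub div_less_copies_iff[OF k0, of i m]
    by (cases "i = m * k") (auto simp: pverts_friendship_graph)
qed

text \<open>
  For a solution \<open>c\<close> of \<open>A c = 1\<^sub>X\<close>, the number \<open>c \<bullet> 1\<^sub>X\<close> depends only on the counts \<open>s j\<close> of \<open>X\<close> in
  the copies and on \<open>a\<close>, because \<open>c\<close> is constant on the intersection of \<open>X\<close> with a copy. Clearing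
  the denominators \<open>k - 1\<close> and \<open>m k\<close> of the solution leaves an equation between integers.
\<close>
lemma friendship_graph_isotropic_equation:
  fixes c :: "nat \<Rightarrow> real" and k m :: nat
  assumes k0: "k > 0" and X: "X \<subseteq> pverts (friendship_graph k m)"
    and sol: "\<forall>i\<in>pverts (friendship_graph k m). sum c (neighbors (friendship_graph k m) i) = of_bool (i \<in> X)"
    and iso: "sum c X = 0"
  defines "s \<equiv> \<lambda>j. int (card (X \<inter> {j * k..<j * k + k}))" and "a \<equiv> of_bool (m * k \<in> X) :: int"
  shows "int (m * k) * ((\<Sum>j<m. (s j)\<^sup>2) - (int k - 1) * (\<Sum>j<m. s j))
      = ((\<Sum>j<m. s j) - a * (int k - 1))\<^sup>2"
proof -
  define x :: "nat \<Rightarrow> real" where "x i = of_bool (i \<in> X)" for i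
  define C where "C j = sum c {j * k..<j * k + k}" for j
  define t where "t j = sum x {j * k..<j * k + k}" for j
  define h where "h = c (m * k)"
  define A where "A = x (m * k)"
  note sys = friendship_graph_linear_system[OF k0 sol, folded x_def, folded C_def t_def h_def A_def]
  have ts: "t j = of_int (s j)" for j
    by (simp add: t_def x_def s_def of_bool_def sum.If_cases Int_commute)
  have Aa: "A = of_int a" by (simp add: A_def x_def a_def)
  define S where "S = (\<Sum>j<m. t j)"
  have "sum c X = (\<Sum>i\<in>{..m * k}. c i * x i)"
    using X by (simp add: x_def of_bool_def pverts_friendship_graph sum.If_cases if_distrib Int_absorb1 cong: if_cong)
  also have "\<dots> = (\<Sum>i<m * k. c i * x i) + h * A"
    by (simp add: lessThan_Suc_atMost[symmetric] h_def A_def)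
  also have "(\<Sum>i<m * k. c i * x i) = (\<Sum>j<m. \<Sum>i\<in>{j * k..<j * k + k}. c i * x i)"
    by (rule sum.nat_group[symmetric])
  also have "\<dots> = (\<Sum>j<m. (C j + h - 1) * t j)"
  proof (rule sum.cong[OF refl])
    fix j assume "j \<in> {..<m}"
    then have "c i * x i = (C j + h - 1) * x i" if "i \<in> {j * k..<j * k + k}" for i
      using sys(1)[of i] in_block_iff[OF k0, of i j] div_less_copies_iff[OF k0, of i m] that
      by (auto simp: x_def)
    then show "(\<Sum>i\<in>{j * k..<j * k + k}. c i * x i) = (C j + h - 1) * t j"
      unfolding t_def sum_distrib_left by (rule sum.cong[OF refl])
  qed
  finally have "(real k - 1) * ((\<Sum>j<m. (C j + h - 1) * t j) + h * A) = 0"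
    using iso by simp
  moreover have "(real k - 1) * ((C j + h - 1) * t j) = (t j)\<^sup>2 - (h + (real k - 1)) * t j" if "j < m" for j
  proof -
    have "(real k - 1) * ((C j + h - 1) * t j) = ((real k - 1) * C j) * t j + (real k - 1) * (h - 1) * t j"
      by (simp add: algebra_simps)
    then show ?thesis unfolding sys(2)[OF that] by (simp add: algebra_simps power2_eq_square)
  qed
  ultimately have "(\<Sum>j<m. (t j)\<^sup>2 - (h + (real k - 1)) * t j) + (real k - 1) * h * A = 0"
    by (simp add: distrib_left sum_distrib_left mult.assoc)
  then have "(\<Sum>j<m. (t j)\<^sup>2) - (real k - 1) * S = h * (S - A * (real k - 1))"
    by (simp add: sum_subtractf sum_distrib_left[symmetric] S_def algebra_simps)
  then have "real (m * k) * ((\<Sum>j<m. (t j)\<^sup>2) - (real k - 1) * S) = (real (m * k) * h) * (S - A * (real k - 1))"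
    by simp
  also have "\<dots> = (S - A * (real k - 1))\<^sup>2"
    unfolding sys(3) S_def by (simp add: power2_eq_square mult.commute)
  finally have "real_of_int (int (m * k) * ((\<Sum>j<m. (s j)\<^sup>2) - (int k - 1) * (\<Sum>j<m. s j)))
      = real_of_int (((\<Sum>j<m. s j) - a * (int k - 1))\<^sup>2)"
    unfolding S_def ts Aa by simp
  then show ?thesis unfolding of_int_eq_iff .
qed

section \<open>The Diophantine equation\<close>

text \<open>
  The entries 0, 1, \<open>k - 1\<close>, \<open>k\<close> are the ones with the least values of \<open>x (k - x)\<close>. Only the
  number of their occurrences matters, and the entries in \<open>T\<close>, which are few in the application,
  are kept.
\<close>
lemma sums_split_off_extreme_entries:
  fixes s :: "'a \<Rightarrow> int" and k :: int
  assumes "finite I" and k: "k \<ge> 4" and s: "\<And>i. i \<in> I \<Longrightarrow> 0 \<le> s i \<and> s i \<le> k"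
  defines "z \<equiv> int (card {i \<in> I. s i = k})"
    and "p \<equiv> int (card {i \<in> I. s i = 1})"
    and "n \<equiv> int (card {i \<in> I. s i = k - 1})"
    and "T \<equiv> {i \<in> I. 2 \<le> s i \<and> s i \<le> k - 2}"
  shows "sum s I = k * z + p + (k - 1) * n + sum s T"
    and "(\<Sum>i\<in>I. s i * (k - s i)) = (k - 1) * (p + n) + (\<Sum>i\<in>T. s i * (k - s i))"
proof -
  have split: "(\<Sum>i\<in>I. g (s i)) = g k * z + g 1 * p + g (k - 1) * n + (\<Sum>i\<in>T. g (s i))"
    if "g 0 = 0" for g :: "int \<Rightarrow> int"
  proof -
    have "g (s i) = (if s i = k then g k else 0) + (if s i = 1 then g 1 else 0)
        + (if s i = k - 1 then g (k - 1) else 0) + (if 2 \<le> s i \<and> s i \<le> k - 2 then g (s i) else 0)"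
      if i: "i \<in> I" for i
    proof -
      consider "s i = 0" | "s i = 1" | "2 \<le> s i \<and> s i \<le> k - 2" | "s i = k - 1" | "s i = k"
        using s[OF i] by linarith
      then show ?thesis
        by cases (use k \<open>g 0 = 0\<close> in auto)
    qed
    then have "(\<Sum>i\<in>I. g (s i)) = (\<Sum>i\<in>I. (if s i = k then g k else 0) + (if s i = 1 then g 1 else 0)
        + (if s i = k - 1 then g (k - 1) else 0) + (if 2 \<le> s i \<and> s i \<le> k - 2 then g (s i) else 0))"
      by (rule sum.cong[OF refl])
    also have "\<dots> = (\<Sum>i\<in>{i\<in>I. s i = k}. g k) + (\<Sum>i\<in>{i\<in>I. s i = 1}. g 1)
        + (\<Sum>i\<in>{i\<in>I. s i = k - 1}. g (k - 1)) + (\<Sum>i\<in>T. g (s i))"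
      unfolding sum.distrib T_def by (simp only: sum.inter_filter[OF \<open>finite I\<close>])
    finally show ?thesis
      unfolding z_def p_def n_def by simp
  qed
  show "sum s I = k * z + p + (k - 1) * n + sum s T"
    using split[of "\<lambda>x. x"] by simp
  show "(\<Sum>i\<in>I. s i * (k - s i)) = (k - 1) * (p + n) + (\<Sum>i\<in>T. s i * (k - s i))"
    using split[of "\<lambda>x. x * (k - x)"] by (simp add: algebra_simps)
qed

text \<open>
  \<open>x (k - x)\<close> is concave and symmetric about \<open>k / 2\<close>.
\<close>
lemma mult_complement_ge:
  fixes x k d :: int
  assumes "d \<le> x" and "x \<le> k - d"
  shows "d * (k - d) \<le> x * (k - x)"
proof -
  have "0 \<le> (x - d) * (k - d - x)"
    using assms by simp
  then show ?thesis by (simp add: algebra_simps)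
qed

text \<open>
  Here \<open>h\<close> is half the number of copies. An entry 1 or \<open>k - 1\<close> contributes \<open>k - 1\<close> to the sum of
  the \<open>s i * (k - s i)\<close>, and an entry in \<open>T\<close> at least \<open>2 (k - 2)\<close>; since the sum is at most
  \<open>3k + a (k - 1)\<close>, this bounds the number of such entries, an entry in \<open>T\<close> counting twice, by
  \<open>3 + a\<close>. On the other hand all entries add up to \<open>-a\<close> modulo \<open>k\<close>. The few configurations
  compatible with this residue force \<open>q = k - 1\<close> or \<open>q = k - 2\<close> (excluded as \<open>k\<close> would divide 4
  or 8), or contradict the parity of \<open>q\<close> or the size of \<open>k\<close>.
\<close>
lemma no_solution_even:
  fixes s :: "'a \<Rightarrow> int" and k q h a :: int
  assumes "finite I" and k: "k \<ge> 11" and s: "\<And>i. i \<in> I \<Longrightarrow> 0 \<le> s i \<and> s i \<le> k"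
    and a: "a = 0 \<or> a = 1" and hk: "h * k = 4 * q" and h: "h \<le> 6" and q: "odd q" "q > 0"
    and sum_s: "sum s I = h * k + a * (k - 1)"
    and sum_f: "(\<Sum>i\<in>I. s i * (k - s i)) = 2 * q + a * (k - 1)"
  shows False
proof -
  define z where "z = int (card {i \<in> I. s i = k})"
  define p where "p = int (card {i \<in> I. s i = 1})"
  define n where "n = int (card {i \<in> I. s i = k - 1})"
  define T where "T = {i \<in> I. 2 \<le> s i \<and> s i \<le> k - 2}"
  note defs = z_def p_def n_def T_def
  have k4: "k \<ge> 4" using k by simp
  have eq1: "h * k + a * (k - 1) = k * z + p + (k - 1) * n + sum s T"
    and eq2: "2 * q + a * (k - 1) = (k - 1) * (p + n) + (\<Sum>i\<in>T. s i * (k - s i))"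
    using sums_split_off_extreme_entries[of I k s, OF \<open>finite I\<close> k4 s, folded defs] sum_s sum_f by (simp_all only:)
  have finT: "finite T" and T: "\<And>i. i \<in> T \<Longrightarrow> 2 \<le> s i \<and> s i \<le> k - 2"
    using \<open>finite I\<close> by (auto simp: T_def)
  have pn: "0 \<le> p" "0 \<le> n" by (simp_all add: defs)
  have q_le: "2 * q \<le> 3 * k"
  proof -
    have "h * k \<le> 6 * k" using h k by (intro mult_right_mono) auto
    then show ?thesis using hk by simp
  qed
  have residue: "\<exists>c. k * c = n - p - sum s T - a"
    using eq1 by (intro exI[of _ "z + n - h - a"]) (simp add: algebra_simps)
  have small: "x = 0" if "\<exists>c. k * c = x" "\<bar>x\<bar> < k" for x
    using that dvd_imp_le_int[of x k] k by (auto simp: dvd_def)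
  have q1: "q \<noteq> k - 1"
  proof
    assume "q = k - 1"
    then have "k * (4 - h) = 4" using hk by (simp add: algebra_simps)
    then show False using small[of 4] k by auto
  qed
  have q2: "q \<noteq> k - 2"
  proof
    assume "q = k - 2"
    then have "k * (4 - h) = 8" using hk by (simp add: algebra_simps)
    then show False using small[of 8] k by auto
  qed
  have "(\<Sum>i\<in>T. s i * (k - s i)) \<ge> (\<Sum>i\<in>T. 2 * (k - 2))"
    using T mult_complement_ge by (intro sum_mono) blast
  then have weight: "(k - 1) * (p + n) + 2 * (k - 2) * int (card T) \<le> 2 * q + a * (k - 1)"
    using eq2 by (simp add: algebra_simps)
  \<comment> \<open>Up to two elements of \<open>T\<close> the loss from \<open>2 (k - 2) < 2 (k - 1)\<close> is at most 4, so that
    \<open>4 (k - 1) - 4 > 3k\<close> suffices; three elements of \<open>T\<close> alone already exceed the bound.\<close>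
  have count: "p + n + 2 * int (card T) \<le> 3 + a"
  proof (rule ccontr)
    assume "\<not> ?thesis"
    then have "p + n + 2 * int (card T) \<ge> 4 + a" by simp
    show False
    proof (cases "card T \<le> 2")
      case True
      have "(k - 1) * (4 + a) \<le> (k - 1) * (p + n + 2 * int (card T))"
        using k \<open>p + n + 2 * int (card T) \<ge> 4 + a\<close> by (intro mult_left_mono) auto
      moreover have "a * (k - 1) \<le> k - 1" using a k by auto
      ultimately show False using weight q_le k True by (simp add: algebra_simps)
    next
      case False
      have "2 * (k - 2) * 3 \<le> 2 * (k - 2) * int (card T)"
        using k False by (intro mult_left_mono) auto
      moreover have "a * (k - 1) \<le> k - 1" using a k by auto
      moreover have "0 \<le> (k - 1) * (p + n)" using k pn by simp
      ultimately show False using weight q_le k by (simp add: algebra_simps)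
    qed
  qed
  then have "card T = 0 \<or> card T = 1 \<or> card T = 2" using a pn by linarith
  then consider "T = {}" | x where "T = {x}" | x y where "T = {x, y}" "x \<noteq> y"
    using finT by (auto simp: card_Suc_eq card_2_iff numeral_2_eq_2)
  then show False
  proof cases
    case 1
    then have "n - p - a = 0"
      using residue small[of "n - p - a"] count pn a k by auto
    \<comment> \<open>So \<open>q\<close> is 0 or \<open>k - 1\<close>.\<close>
    then have "(n = p + a \<and> p = 0) \<or> (n = p + a \<and> p = 1)"
      using count pn a 1 by auto
    then show False
      using eq2 q q1 1 by (auto simp: algebra_simps)
  next
    case 2
    define y where "y = s x"
    have y: "2 \<le> y" "y \<le> k - 2" using T 2 by (auto simp: y_def)
    have eq2': "2 * q + a * (k - 1) = (k - 1) * (p + n) + y * (k - y)"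
      using eq2 2 by (simp add: y_def)
    have res: "\<exists>c. k * c = n - p - y - a" using residue 2 by (simp add: y_def)
    have cnt: "p + n \<le> 1 + a" using count 2 by simp
    \<comment> \<open>With a single entry \<open>y\<close> in \<open>T\<close>, its residue modulo \<open>k\<close> leaves two candidates.\<close>
    have y_val: "y = n - p - a \<or> y = n - p - a + k"
    proof -
      obtain c where c: "k * c = n - p - y - a" using res by auto
      have "k * c < k * 1" using c y cnt pn a k by auto
      then have "c < 1" using k by (subst (asm) mult_less_cancel_left_pos) auto
      have "k * (-2) < k * c" using c y cnt pn a k by auto
      then have "-2 < c" using k by (subst (asm) mult_less_cancel_left_pos) auto
      then have "c = 0 \<or> c = -1" using \<open>c < 1\<close> by linarith
      then show ?thesis using c by auto
    qed
    then have "a = 1 \<and> y = k + n - p - 1"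
      using y cnt pn a k by auto
    moreover from this have "p = 1 \<and> n = 0 \<or> p = 2 \<and> n = 0"
      using y cnt pn by auto
    \<comment> \<open>For \<open>p = 1\<close> the equation gives \<open>q = k - 2\<close>; for \<open>p = 2\<close> it gives \<open>2q = 4k - 10\<close>, more than
      \<open>3k\<close>.\<close>
    ultimately show False
      using eq2' q2 q_le k by (auto simp: algebra_simps)
  next
    case 3
    \<comment> \<open>Two entries in \<open>T\<close> add up to \<open>k - 1\<close> and have product \<open>q\<close>. As \<open>q\<close> is odd, both are at
      least 3, which makes \<open>q\<close> too large.\<close>
    have a1: "a = 1" "p = 0" "n = 0" using count pn a 3 by auto
    define u v where "u = s x" and "v = s y"
    have uv: "2 \<le> u" "u \<le> k - 2" "2 \<le> v" "v \<le> k - 2" using T 3 by (auto simp: u_def v_def)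
    have eq2': "2 * q + (k - 1) = u * (k - u) + v * (k - v)"
      using eq2 3 a1 by (simp add: u_def v_def)
    obtain c where c: "k * c = - u - v - 1" using residue 3 a1 by (auto simp: u_def v_def algebra_simps)
    have "k * c < k * 0" using c uv by auto
    then have "c < 0" using k by (subst (asm) mult_less_cancel_left_pos) auto
    have "k * (-2) < k * c" using c uv by auto
    then have "-2 < c" using k by (subst (asm) mult_less_cancel_left_pos) auto
    then have "c = -1" using \<open>c < 0\<close> by linarith
    then have v: "v = k - 1 - u" using c by simp
    have "q = u * (k - 1 - u)"
      using eq2' unfolding v by (simp add: algebra_simps)
    then have "odd u" "odd v" using q v by auto
    then have "3 \<le> u" "3 \<le> v" using uv by presburger+
    then have "3 * (k - 1 - 3) \<le> u * (k - 1 - u)"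
      using v by (intro mult_complement_ge) auto
    then show False using \<open>q = u * (k - 1 - u)\<close> q_le k by simp
  qed
qed

text \<open>
  The function \<open>x (k - x)\<close> on \<open>{0..k}\<close>, extended with period \<open>k\<close>, is subadditive: for \<open>r + x < k\<close>
  the two sides differ by \<open>2 r x\<close>, and otherwise by \<open>2 (k - r) (k - x)\<close>.
\<close>
lemma mult_complement_mod_subadditive:
  fixes k :: int
  assumes "finite I" and "k > 0" and "\<And>i. i \<in> I \<Longrightarrow> 0 \<le> s i \<and> s i \<le> k"
  shows "(sum s I mod k) * (k - sum s I mod k) \<le> (\<Sum>i\<in>I. s i * (k - s i))"
  using assms(1,3)
proof (induction I)
  case empty
  then show ?case by simp
next
  case (insert i I)
  define r where "r = sum s I mod k"
  have r: "0 \<le> r" "r < k" and x: "0 \<le> s i" "s i \<le> k"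
    using \<open>k > 0\<close> insert.prems by (auto simp: r_def)
  have "sum s (insert i I) mod k = (r + s i) mod k"
    using insert.hyps by (simp add: r_def mod_simps add.commute)
  also have "\<dots> = (if r + s i < k then r + s i else r + s i - k)"
  proof (cases "r + s i < k")
    case False
    then have "(r + s i - k) mod k = r + s i - k"
      using r x by (intro mod_pos_pos_trivial) auto
    then show ?thesis using False by simp
  qed (use r x in simp)
  finally have m: "sum s (insert i I) mod k = (if r + s i < k then r + s i else r + s i - k)" .
  have "0 \<le> r * s i" "0 \<le> (k - r) * (k - s i)"
    using r x by simp_all
  then have "(sum s (insert i I) mod k) * (k - sum s (insert i I) mod k) \<le> r * (k - r) + s i * (k - s i)"
    unfolding m by (auto simp: algebra_simps)
  also have "\<dots> \<le> (\<Sum>i\<in>I. s i * (k - s i)) + s i * (k - s i)"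
    using insert by (auto simp: r_def)
  finally show ?case using insert.hyps by (simp add: add.commute)
qed

text \<open>
  For odd \<open>m\<close> the number \<open>k = 8e\<close> is divisible by 8, and the sum of the entries is
  \<open>k / 2 - a\<close> modulo \<open>k\<close>, close to where \<open>x (k - x)\<close> is largest. By
  subadditivity the sum of the \<open>s i * (k - s i)\<close> is about \<open>k\<^sup>2 / 4\<close> at least, which gives
  \<open>k \<le> m + 4 a\<close>. As \<open>m \<le> 11\<close>, this fails for \<open>k \<ge> 16\<close>.
\<close>
lemma no_solution_odd:
  fixes s :: "'a \<Rightarrow> int" and k q m a :: int
  assumes "finite I" and k: "k \<ge> 11" and s: "\<And>i. i \<in> I \<Longrightarrow> 0 \<le> s i \<and> s i \<le> k"
    and a: "a = 0 \<or> a = 1" and mk: "m * k = 8 * q" and m: "odd m" "m \<le> 12"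
    and sum_s: "sum s I = 4 * q + a * (k - 1)"
    and sum_f: "(\<Sum>i\<in>I. s i * (k - s i)) = 2 * q + a * (k - 1)"
  shows False
proof -
  have "coprime m (2 ^ 3)" using m by (intro coprime_power_right_iff[THEN iffD2] disjI1) simp
  moreover have "2 ^ 3 dvd m * k" using mk by simp
  ultimately have "8 dvd k" by (simp add: coprime_commute coprime_dvd_mult_right_iff)
  then obtain e where e: "k = 8 * e" by auto
  have e2: "e \<ge> 2" using e k by linarith
  have q: "q = m * e" using mk e by simp
  obtain b where b: "m = 2 * b + 1" using m by (auto elim: oddE)
  have "sum s I = (4 * e - a) + (b + a) * k"
    unfolding sum_s q b e by (simp add: algebra_simps)
  then have "sum s I mod k = (4 * e - a) mod k" by simp
  also have "\<dots> = 4 * e - a" using a e e2 by (intro mod_pos_pos_trivial) auto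
  finally have "(4 * e - a) * (k - (4 * e - a)) \<le> 2 * q + a * (k - 1)"
    using mult_complement_mod_subadditive[of I k s, OF \<open>finite I\<close> _ s] k sum_f by simp
  then have "8 * e * e \<le> m * e + a * 4 * e" 
    unfolding e q using a by (auto simp: algebra_simps)
  then have "(8 * e) * e \<le> (m + 4 * a) * e" by (simp add: algebra_simps)
  then have "8 * e \<le> m + 4 * a" using e2 by (subst (asm) mult_le_cancel_right) auto
  moreover have "m \<noteq> 12" using m by auto
  ultimately show False using m a e2 by auto
qed

text \<open>
  The cofactor of \<open>gcd q n\<close> in \<open>q\<close> divides \<open>gcd q n\<close>, so its square divides \<open>q\<close>.
\<close>
lemma dvd_of_squarefree_dvd_power2:
  fixes q n :: nat
  assumes "squarefree q" and "q dvd n\<^sup>2"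
  shows "q dvd n"
proof (cases "q = 0")
  case False
  then obtain r w where r: "q = gcd q n * r" and w: "n = gcd q n * w" and "coprime r w"
    using gcd_coprime_exists[of q n] by (metis gcd_eq_0_iff mult.commute)
  define g where "g = gcd q n"
  have q: "q = g * r" and n: "n = g * w" using r w by (simp_all add: g_def)
  have "g * r dvd g * (g * w\<^sup>2)"
    using assms(2) unfolding q n by (simp add: power2_eq_square algebra_simps)
  then have "r dvd g * w\<^sup>2" using False q by simp
  moreover have "coprime r (w\<^sup>2)" using \<open>coprime r w\<close> by simp
  ultimately have "r dvd g" using coprime_dvd_mult_left_iff by blast
  then have "r\<^sup>2 dvd q" unfolding q by (simp add: power2_eq_square)
  then have "r = 1" using squarefreeD[OF assms(1)] by auto
  then show ?thesis using q n by simp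
qed (use assms in simp)

text \<open>
  \<open>q\<close> divides \<open>t\<close> as it is square-free. As it is also odd, 8 divides the square of \<open>t / q\<close>, hence
  4 divides \<open>t / q\<close>.
\<close>
lemma square_eq_8_squarefree_mult:
  fixes t E :: int and q :: nat
  assumes "squarefree q" and "odd q" and eq: "t\<^sup>2 = 8 * int q * E"
  obtains u where "t = 4 * int q * u" and "E = 2 * int q * u\<^sup>2"
proof -
  have q: "int q > 0" using \<open>odd q\<close> by (auto intro: Nat.gr0I)
  have "int (nat \<bar>t\<bar>) = \<bar>t\<bar>" by simp
  moreover have "int q dvd \<bar>t\<bar>\<^sup>2" using eq by simp
  ultimately have "q dvd (nat \<bar>t\<bar>)\<^sup>2" by (metis int_dvd_int_iff of_nat_power)
  then have "int q dvd int (nat \<bar>t\<bar>)"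
    using dvd_of_squarefree_dvd_power2 assms(1) int_dvd_int_iff by blast
  then have "int q dvd t" by simp
  then obtain w where w: "t = int q * w" by auto
  have "int q * (int q * w\<^sup>2) = int q * (8 * E)"
    using eq by (simp add: w power2_eq_square algebra_simps)
  then have 8: "int q * w\<^sup>2 = 8 * E" using q by simp
  then have "even (int q * w\<^sup>2)" by simp
  then have "even w" using \<open>odd q\<close> by simp
  then obtain v where v: "w = 2 * v" by auto
  have 2: "int q * v\<^sup>2 = 2 * E" using 8 by (simp add: v power2_eq_square ac_simps)
  then have "even (int q * v\<^sup>2)" by simp
  then have "even v" using \<open>odd q\<close> by simp
  then obtain u where u: "v = 2 * u" by auto
  show thesis
    using 2 by (intro that[of u]) (simp_all add: w v u power2_eq_square ac_simps)
qed

text \<open>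
  In the conclusion the three cases are the counts of the empty set, of the neighbourhood of the
  hub, and of the neighbourhood of a vertex in copy \<open>i\<close>.
\<close>
lemma quadratic_count_equation_cases:
  fixes k m q :: nat and s :: "nat \<Rightarrow> int" and a :: int
  assumes k: "k \<ge> 11" and m: "1 \<le> m" "m \<le> 12" and mk: "m * k = 8 * q"
    and q: "squarefree q" "odd q"
    and s: "\<And>j. j < m \<Longrightarrow> 0 \<le> s j \<and> s j \<le> int k"
    and a: "a = 0 \<or> a = 1"
    and eq: "int (m * k) * ((\<Sum>j<m. (s j)\<^sup>2) - (int k - 1) * (\<Sum>j<m. s j))
      = ((\<Sum>j<m. s j) - a * (int k - 1))\<^sup>2"
  shows "(a = 0 \<and> (\<forall>j<m. s j = 0)) \<or> (a = 0 \<and> (\<forall>j<m. s j = int k))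
    \<or> (a = 1 \<and> (\<exists>i<m. s i = int k - 1 \<and> (\<forall>j<m. j \<noteq> i \<longrightarrow> s j = 0)))"
proof -
  define S where "S = (\<Sum>j<m. s j)"
  define Q where "Q = (\<Sum>j<m. (s j)\<^sup>2)"
  have mk': "int m * int k = 8 * int q" using mk by (metis of_nat_mult of_nat_numeral)
  have "(S - a * (int k - 1))\<^sup>2 = 8 * int q * (Q - (int k - 1) * S)"
    using eq mk' by (simp add: S_def Q_def)
  then obtain u where u: "S - a * (int k - 1) = 4 * int q * u"
    and E: "Q - (int k - 1) * S = 2 * int q * u\<^sup>2"
    using square_eq_8_squarefree_mult q by blast
  have q0: "int q > 0" using q by (auto intro: Nat.gr0I)
  have kq: "int k \<le> 8 * int q"
    using mk m by (metis One_nat_def Suc_leI mult_le_mono1 nat_mult_1 of_nat_le_iff of_nat_mult of_nat_numeral)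
  have f_sum: "(\<Sum>j<m. s j * (c - s j)) = c * S - Q" for c
    by (simp add: S_def Q_def sum_distrib_left sum_subtractf[symmetric] power2_eq_square algebra_simps)
  have S0: "0 \<le> S" unfolding S_def using s by (intro sum_nonneg) auto
  have "S \<le> (\<Sum>j<m. int k)" unfolding S_def using s by (intro sum_mono) auto
  then have S8: "S \<le> 8 * int q" using mk' by simp
  have s_le_S: "s j \<le> S" if "j < m" for j
    unfolding S_def using s that by (intro member_le_sum) auto
  have ulow: "-2 < u"
  proof -
    have "a * (int k - 1) \<le> int k - 1" using a k by auto
    then have "4 * int q * (-2) < 4 * int q * u" using u S0 kq by linarith
    then show ?thesis using q0 by (subst (asm) mult_less_cancel_left_pos) auto
  qed
  have uhigh: "u \<le> 2"
  proof -
    have "0 \<le> a * (int k - 1)" using a k by auto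
    then have "4 * int q * u \<le> 4 * int q * 2" using u S8 by linarith
    then show ?thesis using q0 by (subst (asm) mult_le_cancel_left_pos) auto
  qed
  consider "u = -1" | "u = 0" "a = 0" | "u = 0" "a = 1" | "u = 1" | "u = 2"
    using ulow uhigh a by linarith
  then show ?thesis
  proof cases
    case 1
    \<comment> \<open>Here \<open>S \<le> k - 1\<close>, so \<open>\<Sum> s\<^sub>j (k - 1 - s\<^sub>j)\<close> has nonnegative terms, but it equals \<open>-2q\<close>.\<close>
    then have a1: "a = 1" using u S0 q0 a by auto
    then have "s j * (int k - 1 - s j) \<ge> 0" if "j < m" for j
      using s[OF that] s_le_S[OF that] u q0 1 by (intro mult_nonneg_nonneg) auto
    then have "0 \<le> (\<Sum>j<m. s j * (int k - 1 - s j))" by (intro sum_nonneg) auto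
    then show ?thesis using f_sum[of "int k - 1"] E 1 q0 by simp
  next
    case 2
    then have "S = 0" using u by simp
    then have "s j = 0" if "j < m" for j using s[OF that] s_le_S[OF that] by simp
    then show ?thesis using 2 by auto
  next
    case 3
    then have S: "S = int k - 1" using u by simp
    \<comment> \<open>The nonnegative terms \<open>s\<^sub>j (k - 1 - s\<^sub>j)\<close> add up to 0, so every \<open>s\<^sub>j\<close> is 0 or \<open>k - 1\<close>.\<close>
    have nn: "s j * (int k - 1 - s j) \<ge> 0" if "j < m" for j
      using s[OF that] s_le_S[OF that] S by (intro mult_nonneg_nonneg) auto
    have "(\<Sum>j<m. s j * (int k - 1 - s j)) = 0"
      using f_sum[of "int k - 1"] E 3 by simp
    then have val: "s j = 0 \<or> s j = int k - 1" if "j < m" for j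
      using nn that by (subst (asm) sum_nonneg_eq_0_iff) auto
    have "S \<noteq> 0" using S k by simp
    then obtain i where i: "i < m" "s i \<noteq> 0" unfolding S_def by (meson lessThan_iff sum.neutral)
    have "S = s i + sum s ({..<m} - {i})" unfolding S_def using i by (simp add: sum.remove)
    moreover have "S = s i" using S val[OF i(1)] i(2) by linarith
    ultimately have "sum s ({..<m} - {i}) = 0" by linarith
    then have "s j = 0" if "j < m" "j \<noteq> i" for j
      using s that by (subst (asm) sum_nonneg_eq_0_iff) auto
    then show ?thesis using 3 val i by auto
  next
    case 4
    have sum_s: "sum s {..<m} = 4 * int q + a * (int k - 1)" using u 4 by (simp add: S_def)
    have sum_f: "(\<Sum>j<m. s j * (int k - s j)) = 2 * int q + a * (int k - 1)"
      using f_sum[of "int k"] E u 4 by (simp add: algebra_simps)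
    show ?thesis
    proof (cases "even m")
      case True
      then obtain h where h: "m = 2 * h" by auto
      show ?thesis
        using no_solution_even[of "{..<m}" "int k" s a "int h" "int q"] s k a m q q0 mk' h sum_s sum_f
        by auto
    next
      case False
      show ?thesis
        using no_solution_odd[of "{..<m}" "int k" s a "int m" "int q"] s k a m q q0 mk' False sum_s sum_f
        by auto
    qed
  next
    case 5
    then have a0: "a = 0" using u S8 a k by auto
    then have "S = int m * int k" using u mk' 5 by simp
    then have "(\<Sum>j<m. int k - s j) = 0" by (simp add: S_def sum_subtractf)
    then have "s j = int k" if "j < m" for j
      using s that by (subst (asm) sum_nonneg_eq_0_iff) auto
    then show ?thesis using a0 by auto
  qed
qed

section \<open>Maximality of the friendship graph\<close>

theorem theorem11:
  fixes k m q :: nat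
  assumes "k \<ge> 11"
    and "1 \<le> m" and "m \<le> 12"
    and "m * k = 8 * q"
    and "squarefree q" and "odd q" and "q > 0"
  shows "maximal_graph (friendship_graph k m)"
proof (rule maximal_graphI)
  let ?G = "friendship_graph k m"
  let ?B = "\<lambda>j. {j * k..<j * k + k}"
  have k: "k \<ge> 2" "k > 0" using assms by auto
  note nb = neighbors_friendship_graph[OF k(2)]
  show "reduced_graph ?G" using reduced_friendship_graph k assms by simp
  show "\<forall>i\<in>pverts ?G. c i = 0" if "\<forall>i\<in>pverts ?G. sum c (neighbors ?G i) = 0" for c :: "nat \<Rightarrow> real"
    using friendship_graph_nonsingular[OF k(1) assms(2) that] .
  fix X and c :: "nat \<Rightarrow> real"
  assume X: "X \<subseteq> pverts ?G" and sol: "\<forall>i\<in>pverts ?G. sum c (neighbors ?G i) = of_bool (i \<in> X)"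
    and iso: "sum c X = 0"
  define s where "s j = card (X \<inter> ?B j)" for j
  have s_le: "s j \<le> k" for j
    using card_mono[of "?B j" "X \<inter> ?B j"] by (simp add: s_def)
  have "((of_bool (m * k \<in> X) :: int) = 0 \<and> (\<forall>j<m. int (s j) = 0)) \<or>
      ((of_bool (m * k \<in> X) :: int) = 0 \<and> (\<forall>j<m. int (s j) = int k)) \<or>
      ((of_bool (m * k \<in> X) :: int) = 1 \<and>
        (\<exists>i<m. int (s i) = int k - 1 \<and> (\<forall>j<m. j \<noteq> i \<longrightarrow> int (s j) = 0)))"
    using friendship_graph_isotropic_equation[OF k(2) X sol iso, folded s_def] s_le
    by (intro quadratic_count_equation_cases[OF assms(1-6)]) auto
  then consider (none) "m * k \<notin> X" "\<forall>j<m. s j = 0" | (all) "m * k \<notin> X" "\<forall>j<m. s j = k"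
    | (one) i where "m * k \<in> X" "i < m" "int (s i) = int k - 1" "\<forall>j<m. j \<noteq> i \<longrightarrow> s j = 0"
    unfolding of_bool_eq_0_iff of_bool_eq_1_iff of_nat_eq_iff of_nat_eq_0_iff by blast
  moreover have empty: "X \<inter> ?B j = {}" if "s j = 0" for j
    using that by (simp add: s_def)
  moreover have cover: "v \<in> ?B (v div k) \<and> v div k < m" if "v \<in> X" "v \<noteq> m * k" for v
    using that X in_block_iff[OF k(2), of v "v div k"] div_less_copies_iff[OF k(2), of v m]
    by (auto simp: pverts_friendship_graph simp del: atLeastLessThan_iff)
  ultimately show "X = {} \<or> (\<exists>w\<in>pverts ?G. X = neighbors ?G w)"
  proof cases
    case none
    then show ?thesis using empty cover by blast
  next
    case all
    have "v \<in> X" if "v < m * k" for v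
    proof -
      have "v div k < m" "v \<in> ?B (v div k)"
        using that in_block_iff[OF k(2)] div_less_copies_iff[OF k(2)] by blast+
      moreover from this have "X \<inter> ?B (v div k) = ?B (v div k)"
        using all by (intro card_subset_eq) (auto simp: s_def)
      ultimately show ?thesis by blast
    qed
    then have "X = neighbors ?G (m * k)"
      using X all by (auto simp: nb pverts_friendship_graph le_less)
    then show ?thesis by (auto simp: pverts_friendship_graph)
  next
    case one
    have "s i = k - 1"
      using one(3) k by linarith
    \<comment> \<open>The vertex missing from copy \<open>i\<close> is the one whose neighbourhood is \<open>X\<close>.\<close>
    then have "card (?B i - X) = 1"
      using k card_Diff_subset_Int[of "?B i" X] by (simp add: s_def Int_commute)
    then obtain w where w: "?B i - X = {w}" by (auto simp: card_1_singleton_iff)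
    then have wi: "w div k = i" using in_block_iff[OF k(2)] by blast
    then have wm: "w < m * k" using one div_less_copies_iff[OF k(2)] by blast
    have "X = insert (m * k) (?B i - {w})"
    proof (intro equalityI subsetI)
      fix v assume v: "v \<in> X"
      show "v \<in> insert (m * k) (?B i - {w})"
      proof (cases "v = m * k")
        case False
        note block = cover[OF v False]
        have "X \<inter> ?B (v div k) \<noteq> {}" using block v by blast
        then have "v div k = i" using block one(4) empty by metis
        then have "v \<in> ?B i" using block by metis
        moreover have "v \<noteq> w" using v w by blast
        ultimately show ?thesis by blast
      qed simp
    next
      fix v assume "v \<in> insert (m * k) (?B i - {w})"
      then consider "v = m * k" | "v \<in> ?B i" "v \<noteq> w" by blast
      then show "v \<in> X"
        using one(1) w by cases blast+
    qed
    then have "X = neighbors ?G w" using wm wi by (simp add: nb)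
    then show ?thesis using wm by (auto simp: pverts_friendship_graph)
  qed
qed

end
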